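(* Let $L$ be convex concave and let $(p,q)\in\mathrm{Solution}(L)$. Let $R_{f_i}$ and $R_{g_j}$ be the sets of regular values of $f_i$ and $g_j$ respectively. Assume there is $\xi>0$ such that $[p_i-\xi,p_i+\xi]\subseteq R_{f_i}$ for all $1\le i\le n$ and $[q_j-\xi,q_j+\xi]\subseteq R_{g_j}$ for all $1\le j\le m$. For a solution $(\theta(t),\phi(t))$ of the gradient descent ascent dynamics define $$r(t)=\|F(\theta(t))-p\|^2+\|G(\phi(t))-q\|^2 .$$ If all $f_i$ and $g_j$ are proper functions, then for every $\epsilon>0$ there is $\delta>0$ such that for every solution of the gradient descent ascent dynamics $$r(0)<\delta\ \Longrightarrow\ \forall t\ge 0:\ r(t)<\epsilon .$$
   Context: Setting: $n,m,n_1,\dots,n_n,m_1,\dots,m_m$ are positive integers, $N=\sum_i n_i$, $M=\sum_j m_j$; $f_i:\mathbb{R}^{n_i}\to\mathbb{R}$, $g_j:\mathbb{R}^{m_j}\to\mathbb{R}$ and $L:\mathbb{R}^n\times\mathbb{R}^m\to\mathbb{R}$, $(x,y)\mapsto L(x,y)$, are $C^2$. Write $\theta=(\theta_1,\dots,\theta_n)\in\mathbb{R}^N$, $\theta_i\in\mathbb{R}^{n_i}$, $\phi=(\phi_1,\dots,\phi_m)\in\mathbb{R}^M$, $\phi_j\in\mathbb{R}^{m_j}$, and $F(\theta)=(f_1(\theta_1),\dots,f_n(\theta_n))$, $G(\phi)=(g_1(\phi_1),\dots,g_m(\phi_m))$. The norm is Euclidean. Convex concave: $L(\cdot,y)$ is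 convex for every $y\in\mathbb{R}^m$ and $L(x,\cdot)$ is concave for every $x\in\mathbb{R}^n$. $\mathrm{Solution}(L)$ is the set of equilibria of $L$: pairs $(p,q)$ with $L(p,y)\le L(p,q)\le L(x,q)$ for all $x\in\mathbb{R}^n,y\in\mathbb{R}^m$ (for convex concave $L$, equivalently the stationary points of $L$). Gradient descent ascent (GDA) dynamics: $\dot\theta_i=-\nabla f_i(\theta_i)\,\frac{\partial L}{\partial x_i}(F(\theta),G(\phi))$, $\dot\phi_j=\nabla g_j(\phi_j)\,\frac{\partial L}{\partial y_j}(F(\theta),G(\phi))$. A value $a$ in the image of $f$ is a regular value of $f$ if $\nabla f(w)\neq 0$ for every $w$ in the domain of $f$ with $f(w)=a$ (in particular, here a regular value belongs to the image of $f$). A function is proper if inverse images of compact subsets are compact. *)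

theory Defs
  imports "HOL-Analysis.Analysis"
begin

text \<open>
  The spaces of dimensions $n_1, \dots, n_n$ are realised as the coordinate blocks of one space
  \<open>real^'k\<close> with \<open>CARD('k) = N\<close>: a labelling \<open>b :: 'k \<Rightarrow> 'n\<close> assigns every coordinate of $\theta$
  to its block, so that $n_i$ is the number of coordinates labelled \<open>i\<close>, and all $n_i$ are
  positive iff \<open>b\<close> is surjective. The space of dimension $n_i$ is identified with
  \<open>block_space b i\<close>, and the component $\theta_i$ with \<open>block b i \<theta>\<close>. A function on it
  is a function on \<open>real^'k\<close> of which only the values on \<open>block_space b i\<close> matter.
\<close>

definition block_space :: "('k::finite \<Rightarrow> 'n) \<Rightarrow> 'n \<Rightarrow> (real^'k) set" where
  "block_space b i = {w. \<forall>k. b k \<noteq> i \<longrightarrow> w $ k = 0}"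

definition block :: "('k::finite \<Rightarrow> 'n) \<Rightarrow> 'n \<Rightarrow> real^'k \<Rightarrow> real^'k" where
  "block b i \<theta> = (\<chi> k. if b k = i then \<theta> $ k else 0)"

text \<open>
  In the following definitions \<open>S\<close> is a linear subspace, and everything is relative to \<open>S\<close>.
  A derivative within \<open>S\<close> is determined only on \<open>S\<close>; requiring the gradient to lie in \<open>S\<close>
  makes it unique.
\<close>

definition C2_on :: "'a::real_normed_vector set \<Rightarrow> ('a \<Rightarrow> real) \<Rightarrow> bool" where
  "C2_on S f \<longleftrightarrow>
    (\<exists>(f' :: 'a \<Rightarrow> 'a \<Rightarrow>\<^sub>L real) (f'' :: 'a \<Rightarrow> 'a \<Rightarrow>\<^sub>L 'a \<Rightarrow>\<^sub>L real).
      (\<forall>w\<in>S. (f has_derivative blinfun_apply (f' w)) (at w within S)) \<and>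
      (\<forall>w\<in>S. (f' has_derivative blinfun_apply (f'' w)) (at w within S)) \<and>
      continuous_on S f'')"

definition gradient_on :: "'a::real_inner set \<Rightarrow> ('a \<Rightarrow> real) \<Rightarrow> 'a \<Rightarrow> 'a" where
  "gradient_on S f w =
    (THE v. v \<in> S \<and> (f has_derivative (\<lambda>h. v \<bullet> h)) (at w within S))"

definition regular_values :: "'a::real_inner set \<Rightarrow> ('a \<Rightarrow> real) \<Rightarrow> real set" where
  "regular_values S f = {c \<in> f ` S. \<forall>w\<in>S. f w = c \<longrightarrow> gradient_on S f w \<noteq> 0}"

definition proper_on :: "'a::topological_space set \<Rightarrow> ('a \<Rightarrow> real) \<Rightarrow> bool" where
  "proper_on S f \<longleftrightarrow> (\<forall>K. compact K \<longrightarrow> compact {w \<in> S. f w \<in> K})"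

definition convex_concave :: "('a::real_vector \<times> 'b::real_vector \<Rightarrow> real) \<Rightarrow> bool" where
  "convex_concave L \<longleftrightarrow>
    (\<forall>y. convex_on UNIV (\<lambda>x. L (x, y))) \<and> (\<forall>x. concave_on UNIV (\<lambda>y. L (x, y)))"

definition Solution :: "('a \<times> 'b \<Rightarrow> real) \<Rightarrow> ('a \<times> 'b) set" where
  "Solution L = {(p, q). \<forall>x y. L (p, y) \<le> L (p, q) \<and> L (p, q) \<le> L (x, q)}"

definition partial_x ::
  "((real^'n::finite) \<times> (real^'m::finite) \<Rightarrow> real) \<Rightarrow> 'n \<Rightarrow> real^'n \<Rightarrow> real^'m \<Rightarrow> real" where
  "partial_x L i x y = deriv (\<lambda>s. L (x + s *\<^sub>R axis i 1, y)) 0"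

definition partial_y ::
  "((real^'n::finite) \<times> (real^'m::finite) \<Rightarrow> real) \<Rightarrow> 'm \<Rightarrow> real^'n \<Rightarrow> real^'m \<Rightarrow> real" where
  "partial_y L j x y = deriv (\<lambda>s. L (x, y + s *\<^sub>R axis j 1)) 0"

definition hidden_map ::
  "('k::finite \<Rightarrow> 'n::finite) \<Rightarrow> ('n \<Rightarrow> real^'k \<Rightarrow> real) \<Rightarrow> real^'k \<Rightarrow> real^'n" where
  "hidden_map b f \<theta> = (\<chi> i. f i (block b i \<theta>))"

text \<open>
  On a time interval \<open>J\<close> the derivative is one-sided at endpoints belonging to \<open>J\<close>.
\<close>

definition gda_solution ::
  "('k::finite \<Rightarrow> 'n::finite) \<Rightarrow> ('l::finite \<Rightarrow> 'm::finite) \<Rightarrow>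
   ('n \<Rightarrow> real^'k \<Rightarrow> real) \<Rightarrow> ('m \<Rightarrow> real^'l \<Rightarrow> real) \<Rightarrow>
   ((real^'n) \<times> (real^'m) \<Rightarrow> real) \<Rightarrow>
   real set \<Rightarrow> (real \<Rightarrow> real^'k) \<Rightarrow> (real \<Rightarrow> real^'l) \<Rightarrow> bool" where
  "gda_solution b c f g L J \<theta> \<phi> \<longleftrightarrow>
    (\<forall>t\<in>J.
      (\<forall>i. ((\<lambda>s. block b i (\<theta> s)) has_vector_derivative
              - partial_x L i (hidden_map b f (\<theta> t)) (hidden_map c g (\<phi> t)) *\<^sub>R
                gradient_on (block_space b i) (f i) (block b i (\<theta> t))) (at t within J)) \<and>
      (\<forall>j. ((\<lambda>s. block c j (\<phi> s)) has_vector_derivative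
              partial_y L j (hidden_map b f (\<theta> t)) (hidden_map c g (\<phi> t)) *\<^sub>R
                gradient_on (block_space c j) (g j) (block c j (\<phi> t))) (at t within J)))"

end

theory Submission
  imports Defs
begin

text \<open>
  In the variables \<open>x = F \<theta>\<close> and \<open>y = G \<phi>\<close> the dynamics read \<open>x_i' = - |gradient f_i|\<^sup>2 \<partial>L/\<partial>x_i\<close>
  and \<open>y_j' = |gradient g_j|\<^sup>2 \<partial>L/\<partial>y_j\<close>. Without the factors \<open>|gradient|\<^sup>2\<close> the squared distance
  \<open>r\<close> to the equilibrium \<open>(p, q)\<close> of the convex-concave \<open>L\<close> would be nonincreasing. The factors
  distort this, and they depend on \<open>\<theta>\<close> and \<open>\<phi>\<close>, not on \<open>x\<close> and \<open>y\<close>.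

  The idea is that along one trajectory they do depend on \<open>x\<close> and \<open>y\<close> only. Each \<open>\<theta>_i\<close> moves
  parallel to the gradient of \<open>f_i\<close>, hence back and forth on a single gradient curve by uniqueness for
  ordinary differential equations; this is where the second derivatives are needed. On that curve, away
  from critical points, \<open>f_i\<close> is strictly monotone, so \<open>|gradient f_i|\<^sup>2\<close> is a
  function \<open>\<rho>_i\<close> of \<open>x_i\<close>. Weighting the displacements accordingly, one gets for each trajectory the energy
  \<open>H\<close> that sums the integrals of \<open>(z - p_i) / \<rho>_i z\<close> from \<open>p_i\<close> to \<open>x_i\<close> and
  those of the other player. The factors cancel in \<open>H'\<close>, which is
  then nonpositive because \<open>L\<close> is convex-concave (\<open>saddle_monotonicity\<close>).

  The energy varies with the trajectory, and stability needs one \<open>\<delta>\<close> for all of them. This is what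
  properness gives: the points with \<open>f_i\<close> in \<open>[p_i - \<xi>, p_i + \<xi>]\<close> form a compact set of regular
  points, on which \<open>|gradient f_i|\<^sup>2\<close> lies between two positive constants
  (\<open>gradient_field_normalised\<close>). Therefore \<open>\<alpha> * r \<le> H \<le> \<beta> * r\<close> with \<open>\<alpha>\<close> and \<open>\<beta>\<close>
  common to all trajectories that stay near \<open>(p, q)\<close> (\<open>coordinate_energy\<close>, \<open>player_energy\<close>). A
  trajectory that starts with \<open>r\<close> small then has small \<open>H\<close>, and \<open>r\<close> cannot grow beyond the
  factor \<open>\<beta> / \<alpha>\<close>; a first exit time argument shows that it never leaves the region where this applies.
\<close>

section \<open>Gradients relative to a subspace\<close>

text \<open>
  A derivative within \<open>S\<close> sees only the directions of \<open>S\<close>: two candidates have the same inner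
  product with every vector of \<open>S\<close>, in particular with their own difference.
\<close>

lemma gradient_on_eqI:
  fixes S :: "'a::euclidean_space set"
  assumes S: "subspace S" and w: "w \<in> S" and v: "v \<in> S"
    and der: "(f has_derivative (\<lambda>h. v \<bullet> h)) (at w within S)"
  shows "gradient_on S f w = v"
  unfolding gradient_on_def
proof (rule the_equality)
  fix v' assume v': "v' \<in> S \<and> (f has_derivative (\<lambda>h. v' \<bullet> h)) (at w within S)"
  define u where "u = v - v'"
  have u: "u \<in> S" using v v' S by (simp add: u_def subspace_diff)
  have line: "w + s *\<^sub>R u \<in> S" for s :: real
    using S w u by (simp add: subspace_add subspace_mul)
  have *: "((\<lambda>s. f (w + s *\<^sub>R u)) has_real_derivative x \<bullet> u) (at 0)"
    if x: "(f has_derivative (\<lambda>h. x \<bullet> h)) (at w within S)" for x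
  proof -
    have g: "((\<lambda>s::real. w + s *\<^sub>R u) has_derivative (\<lambda>h. h *\<^sub>R u)) (at 0)"
      by (auto intro!: derivative_eq_intros)
    have "(f has_derivative (\<lambda>h. x \<bullet> h)) (at (w + 0 *\<^sub>R u) within range (\<lambda>s. w + s *\<^sub>R u))"
      using x by (simp, rule has_derivative_subset) (use line in auto)
    from has_derivative_in_compose[OF g this] show ?thesis
      by (simp add: has_field_derivative_def mult_commute_abs)
  qed
  have "v \<bullet> u = v' \<bullet> u" using DERIV_unique[OF *[OF der] *] v' by blast
  then have "u \<bullet> u = 0" by (simp add: u_def inner_diff_left)
  then show "v' = v" by (simp add: u_def)
qed (use v der in simp)

text \<open>
  In an orthonormal basis of \<open>S\<close> the coordinates of the gradient are the values of the derivative
  \<open>f'\<close> on the basis vectors. So the gradient depends linearly on \<open>f'\<close>, and is Lipschitz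
  like \<open>f'\<close> on convex compact sets, where \<open>f''\<close> is bounded.
\<close>

lemma C2_on_gradient:
  fixes S :: "'a::euclidean_space set"
  assumes S: "subspace S" and f: "C2_on S f"
  shows gradient_on_mem: "\<And>w. w \<in> S \<Longrightarrow> gradient_on S f w \<in> S"
    and has_derivative_gradient_on:
      "\<And>w. w \<in> S \<Longrightarrow> (f has_derivative (\<lambda>h. gradient_on S f w \<bullet> h)) (at w within S)"
    and gradient_on_lipschitz:
      "\<And>C. compact C \<Longrightarrow> convex C \<Longrightarrow> C \<subseteq> S \<Longrightarrow> \<exists>K. K-lipschitz_on C (gradient_on S f)"
proof -
  obtain f' :: "'a \<Rightarrow> 'a \<Rightarrow>\<^sub>L real" and f'' :: "'a \<Rightarrow> 'a \<Rightarrow>\<^sub>L 'a \<Rightarrow>\<^sub>L real"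
    where f': "\<And>w. w \<in> S \<Longrightarrow> (f has_derivative blinfun_apply (f' w)) (at w within S)"
      and f'': "\<And>w. w \<in> S \<Longrightarrow> (f' has_derivative blinfun_apply (f'' w)) (at w within S)"
      and cont: "continuous_on S f''"
    using f unfolding C2_on_def by blast
  obtain B where B: "B \<subseteq> S" "pairwise orthogonal B" "\<And>x. x \<in> B \<Longrightarrow> norm x = 1"
    "independent B" "span B = S"
    using orthonormal_basis_subspace[OF S] by metis
  have fin: "finite B" using B(4) by (rule independent_imp_finite)
  define v where "v w = (\<Sum>e\<in>B. f' w e *\<^sub>R e)" for w
  have vS: "v w \<in> S" for w
    unfolding v_def using S B(1) by (auto intro!: subspace_sum subspace_mul)
  have v: "v w \<bullet> h = f' w h" if "h \<in> S" for w h
  proof -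
    have "h = (\<Sum>e\<in>B. (h \<bullet> e) *\<^sub>R e)"
      using orthonormal_basis_expand[OF B(2,3) _ fin, of h] that B(5) by simp
    then have "f' w h = f' w (\<Sum>e\<in>B. (h \<bullet> e) *\<^sub>R e)" by simp
    also have "\<dots> = (\<Sum>e\<in>B. (h \<bullet> e) * f' w e)"
      by (simp add: blinfun.sum_right blinfun.scaleR_right)
    also have "\<dots> = v w \<bullet> h"
      unfolding v_def by (simp add: inner_sum_left inner_commute[of h] mult.commute)
    finally show ?thesis by simp
  qed
  have der: "(f has_derivative (\<lambda>h. v w \<bullet> h)) (at w within S)" if w: "w \<in> S" for w
    unfolding has_derivative_within
  proof
    show "bounded_linear ((\<bullet>) (v w))" by (rule bounded_linear_inner_right)
    have "((\<lambda>y. (1 / norm (y - w)) *\<^sub>R (f y - (f w + f' w (y - w)))) \<longlongrightarrow> 0) (at w within S)"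
      using f'[OF w] unfolding has_derivative_within by blast
    then show "((\<lambda>y. (1 / norm (y - w)) *\<^sub>R (f y - (f w + v w \<bullet> (y - w)))) \<longlongrightarrow> 0) (at w within S)"
      by (rule Lim_transform_eventually)
        (use w S v in \<open>auto simp: eventually_at_filter subspace_diff intro!: always_eventually\<close>)
  qed
  have grad: "gradient_on S f w = v w" if "w \<in> S" for w
    by (rule gradient_on_eqI[OF S that vS der[OF that]])
  show "gradient_on S f w \<in> S" if "w \<in> S" for w using grad[OF that] vS by simp
  show "(f has_derivative (\<lambda>h. gradient_on S f w \<bullet> h)) (at w within S)" if "w \<in> S" for w
    using grad[OF that] der[OF that] by simp
  show "\<exists>K. K-lipschitz_on C (gradient_on S f)" if C: "compact C" "convex C" "C \<subseteq> S" for C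
  proof -
    have "bounded (f'' ` C)"
      using C cont by (meson compact_continuous_image compact_imp_bounded continuous_on_subset)
    then obtain M where M: "M > 0" "\<And>w. w \<in> C \<Longrightarrow> norm (f'' w) \<le> M"
      unfolding bounded_pos by auto
    have lip: "norm (f' x - f' y) \<le> M * norm (x - y)" if "x \<in> C" "y \<in> C" for x y
      by (rule differentiable_bound[OF C(2), of f' "\<lambda>w. blinfun_apply (f'' w)"])
        (use that C(3) M f'' in \<open>auto simp flip: norm_blinfun.rep_eq intro: has_derivative_subset\<close>)
    have "(real (card B) * M)-lipschitz_on C (gradient_on S f)"
    proof (rule lipschitz_onI)
      fix x y assume xy: "x \<in> C" "y \<in> C"
      have "norm (v x - v y) = norm (\<Sum>e\<in>B. (f' x - f' y) e *\<^sub>R e)"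
        by (simp add: v_def sum_subtractf blinfun.diff_left scaleR_diff_left)
      also have "\<dots> \<le> (\<Sum>e\<in>B. M * norm (x - y))"
      proof (rule sum_norm_le)
        fix e assume e: "e \<in> B"
        have "norm ((f' x - f' y) e) \<le> norm (f' x - f' y) * norm e" by (rule norm_blinfun)
        then show "norm ((f' x - f' y) e *\<^sub>R e) \<le> M * norm (x - y)"
          using B(3)[OF e] lip[OF xy] by simp
      qed
      finally show "dist (gradient_on S f x) (gradient_on S f y) \<le> real (card B) * M * dist x y"
        using xy C(3) grad by (simp add: dist_norm subset_iff)
    qed (use M in simp)
    then show ?thesis ..
  qed
qed

section \<open>Existence and uniqueness for autonomous equations\<close>

text \<open>
  The case of Gronwall's inequality that gives uniqueness: the factor \<open>exp (- 2 * M * t)\<close> makes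
  the squared norm of \<open>u\<close> nonincreasing.
\<close>

lemma gronwall_zero:
  fixes u :: "real \<Rightarrow> 'a::euclidean_space"
  assumes der: "\<And>t. t \<in> {0..T} \<Longrightarrow> (u has_vector_derivative u' t) (at t within {0..T})"
    and bound: "\<And>t. t \<in> {0..T} \<Longrightarrow> norm (u' t) \<le> M * norm (u t)"
    and init: "u 0 = 0" and t: "t \<in> {0..T}"
  shows "u t = 0"
proof -
  define E where "E s = exp (- 2 * M * s) * (u s \<bullet> u s)" for s
  define E' where "E' s = exp (- 2 * M * s) * (2 * (u s \<bullet> u' s) - 2 * M * (u s \<bullet> u s))" for s
  have E: "(E has_derivative (\<lambda>h. h * E' s)) (at s within {0..T})" if "s \<in> {0..T}" for s
    unfolding E_def E'_def
    using der[OF that, unfolded has_vector_derivative_def]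
    by (auto intro!: derivative_eq_intros ext simp: algebra_simps inner_commute)
  have neg: "E' s \<le> 0" if "s \<in> {0..T}" for s
  proof -
    have "u s \<bullet> u' s \<le> norm (u s) * norm (u' s)" by (rule norm_cauchy_schwarz)
    also have "\<dots> \<le> norm (u s) * (M * norm (u s))"
      by (rule mult_left_mono[OF bound[OF that]]) simp
    also have "\<dots> = M * (u s \<bullet> u s)" by (simp add: dot_square_norm power2_eq_square)
    finally show ?thesis unfolding E'_def by (intro mult_nonneg_nonpos) auto
  qed
  have "\<exists>x\<in>{0..t}. E t - E 0 = (t - 0) * E' x"
    by (rule mvt_very_simple) (use t in \<open>auto intro!: has_derivative_subset[OF E]\<close>)
  then obtain x where "x \<in> {0..t}" "E t - E 0 = t * E' x" by auto
  then have "E t \<le> 0"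
    using t neg[of x] init by (simp add: E_def mult_nonneg_nonpos)
  then have "u t \<bullet> u t \<le> 0" by (simp add: E_def mult_le_0_iff)
  then show ?thesis by (metis inner_eq_zero_iff inner_ge_zero order_antisym)
qed

text \<open>
  The contraction argument of Picard and Lindeloef. The interval is so short that the
  Picard operator at least halves distances in the supremum norm.
\<close>

lemma picard_lindelof_short_interval:
  fixes V :: "'a::euclidean_space \<Rightarrow> 'a"
  assumes V: "K-lipschitz_on UNIV V" and z0: "z0 \<in> {lo..hi}" and short: "K * (hi - lo) \<le> 1/2"
  obtains X where "X z0 = w0"
    and "\<And>z. z \<in> {lo..hi} \<Longrightarrow> (X has_vector_derivative V (X z)) (at z within {lo..hi})"
proof -
  have contV: "continuous_on UNIV V" using V by (rule lipschitz_on_continuous_on)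
  have K: "K \<ge> 0" using V by (rule lipschitz_on_nonneg)
  have "\<exists>G::real \<Rightarrow>\<^sub>C 'a. G z0 = w0 \<and> (\<forall>z\<in>{lo..hi}.
      (G has_vector_derivative V (X z)) (at z within {lo..hi})) \<and> (\<forall>z. G z = G (clamp lo hi z))"
    for X :: "real \<Rightarrow>\<^sub>C 'a"
  proof -
    have "continuous_on {lo..hi} (\<lambda>z. V (X z))"
      by (rule continuous_on_compose2[OF contV]) auto
    then obtain G where G: "\<And>z. z \<in> {lo..hi} \<Longrightarrow>
        (G has_vector_derivative V (X z)) (at z within {lo..hi})"
      using antiderivative_continuous by blast
    define G0 where "G0 z = w0 + (G z - G z0)" for z
    have G0: "(G0 has_vector_derivative V (X z)) (at z within {lo..hi})" if "z \<in> {lo..hi}" for z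
      unfolding G0_def by (auto intro!: derivative_eq_intros G that)
    have "continuous_on (cbox lo hi) G0"
      unfolding cbox_interval by (rule continuous_on_vector_derivative[OF G0])
    then obtain H :: "real \<Rightarrow>\<^sub>C 'a" where H: "\<And>x. x \<in> cbox lo hi \<Longrightarrow> H x = G0 x"
      "\<And>x. H x = G0 (clamp lo hi x)"
      using continuous_on_cbox_bcontfunE by blast
    have "(H has_vector_derivative V (X z)) (at z within {lo..hi})" if "z \<in> {lo..hi}" for z
      by (rule has_vector_derivative_transform[OF that _ G0[OF that]]) (simp add: H(1))
    moreover have "H z = H (clamp lo hi z)" for z
    proof -
      have "clamp lo hi z \<in> cbox lo hi" using z0 by (intro clamp_in_interval) auto
      from H(1)[OF this] H(2)[of z] show ?thesis by metis
    qed
    moreover have "H z0 = w0" using H(1)[of z0] z0 by (simp add: G0_def)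
    ultimately show ?thesis by blast
  qed
  then obtain P :: "(real \<Rightarrow>\<^sub>C 'a) \<Rightarrow> (real \<Rightarrow>\<^sub>C 'a)" where
    \<comment> \<open>the Picard operator; its values are extended by constants outside the interval\<close>
    P0: "\<And>X. P X z0 = w0" and
    P: "\<And>X z. z \<in> {lo..hi} \<Longrightarrow> (P X has_vector_derivative V (X z)) (at z within {lo..hi})" and
    Pc: "\<And>X z. P X z = P X (clamp lo hi z)"
    by metis
  have "dist (P X) (P Y) \<le> 1/2 * dist X Y" for X Y
  proof (rule dist_bound)
    fix x
    define z where "z = clamp lo hi x"
    have z: "z \<in> {lo..hi}" unfolding z_def using z0 clamp_in_interval[of lo hi x] by auto
    have "norm ((P X z - P Y z) - (P X z0 - P Y z0)) \<le> (K * dist X Y) * norm (z - z0)"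
    proof (rule differentiable_bound[of "{lo..hi}" "\<lambda>z. P X z - P Y z" "\<lambda>z h. h *\<^sub>R (V (X z) - V (Y z))"])
      fix s assume s: "s \<in> {lo..hi}"
      show "((\<lambda>z. P X z - P Y z) has_derivative (\<lambda>h. h *\<^sub>R (V (X s) - V (Y s)))) (at s within {lo..hi})"
        unfolding has_vector_derivative_def[symmetric]
        by (intro has_vector_derivative_diff P s)
      have "norm (V (X s) - V (Y s)) \<le> K * dist (X s) (Y s)"
        using lipschitz_onD[OF V, of "X s" "Y s"] by (simp add: dist_norm)
      also have "\<dots> \<le> K * dist X Y" by (intro mult_left_mono dist_bounded K)
      finally show "onorm (\<lambda>h. h *\<^sub>R (V (X s) - V (Y s))) \<le> K * dist X Y"
        by (intro onorm_le) (simp add: mult.commute mult_left_mono)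
    qed (use z z0 in auto)
    also have "\<dots> \<le> (K * dist X Y) * (hi - lo)"
      using z z0 K by (intro mult_left_mono) (auto simp: mult_nonneg_nonneg)
    also have "\<dots> \<le> 1/2 * dist X Y"
      using mult_right_mono[OF short, of "dist X Y"] by (simp add: mult_ac)
    finally show "dist (P X x) (P Y x) \<le> 1/2 * dist X Y"
      using P0 Pc[of X x] Pc[of Y x] by (simp add: dist_norm z_def)
  qed
  then obtain X where X: "P X = X"
    using banach_fix_type[of "1/2" P] by auto
  show thesis
    by (rule that[of X]) (use P0[of X] P[of _ X] X in auto)
qed

section \<open>The energy of one coordinate\<close>

text \<open>
  A function that vanishes at \<open>p\<close> and grows away from \<open>p\<close> is nonnegative. This compares the energy
  of a coordinate with multiples of \<open>(z - p)\<^sup>2\<close>.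
\<close>

lemma nonneg_of_derivative_sign:
  fixes D :: "real \<Rightarrow> real"
  assumes der: "\<And>z. z \<in> {lo..hi} \<Longrightarrow> (D has_real_derivative (z - p) * e z) (at z within {lo..hi})"
    and e: "\<And>z. z \<in> {lo..hi} \<Longrightarrow> e z \<ge> 0"
    and p: "p \<in> {lo..hi}" "D p = 0" and z: "z \<in> {lo..hi}"
  shows "D z \<ge> 0"
proof -
  define a b where "a = min p z" and "b = max p z"
  have sub: "{a..b} \<subseteq> {lo..hi}" using p z by (auto simp: a_def b_def)
  have "\<exists>x\<in>{a..b}. D b - D a = (x - p) * e x * (b - a)"
  proof (rule mvt_very_simple[of a b D "\<lambda>x h. (x - p) * e x * h"])
    fix x assume "a \<le> x" "x \<le> b"
    then show "(D has_derivative (*) ((x - p) * e x)) (at x within {a..b})"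
      using der[of x] has_derivative_subset[OF _ sub] sub
      unfolding has_field_derivative_def by auto
  qed (simp add: a_def b_def)
  then obtain x where x: "x \<in> {a..b}" "D b - D a = (x - p) * e x * (b - a)" by auto
  have ex: "e x \<ge> 0" using x(1) sub by (auto intro: e)
  show ?thesis
  proof (cases "z \<le> p")
    case True
    then have ab: "a = z" "b = p" by (auto simp: a_def b_def)
    have "(x - p) * e x * (p - z) \<le> 0"
      using x(1) ab ex True by (intro mult_nonpos_nonneg) auto
    then show ?thesis using x ab p(2) by simp
  next
    case False
    then have ab: "a = p" "b = z" by (auto simp: a_def b_def)
    have "(x - p) * e x * (z - p) \<ge> 0"
      using x(1) ab ex False by (intro mult_nonneg_nonneg) auto
    then show ?thesis using x ab p(2) by simp
  qed
qed

text \<open>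
  A trajectory that is everywhere tangent to \<open>V\<close>, with a speed of varying sign, runs back and forth
  along one integral curve of \<open>V\<close>. Here \<open>x\<close> is the clock of the trajectory: both
  \<open>\<theta>\<close> and \<open>X \<circ> x\<close> solve \<open>u' = x' *\<^sub>R V u\<close> with the same initial value.
\<close>

lemma time_change_unique:
  fixes V :: "'a::euclidean_space \<Rightarrow> 'a"
  assumes V: "K-lipschitz_on UNIV V"
    and X: "\<And>z. z \<in> {lo..hi} \<Longrightarrow> (X has_vector_derivative V (X z)) (at z within {lo..hi})"
    and x: "\<And>t. t \<in> {0..T} \<Longrightarrow> (x has_real_derivative x' t) (at t within {0..T})"
    and x_in: "\<And>t. t \<in> {0..T} \<Longrightarrow> x t \<in> {lo..hi}"
    and x'_bound: "\<And>t. t \<in> {0..T} \<Longrightarrow> \<bar>x' t\<bar> \<le> M"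
    and \<theta>: "\<And>t. t \<in> {0..T} \<Longrightarrow> (\<theta> has_vector_derivative x' t *\<^sub>R V (\<theta> t)) (at t within {0..T})"
    and init: "X (x 0) = \<theta> 0" and t: "t \<in> {0..T}"
  shows "\<theta> t = X (x t)"
proof -
  have K: "K \<ge> 0" using V by (rule lipschitz_on_nonneg)
  have "\<theta> t - X (x t) = 0"
  proof (rule gronwall_zero[where T=T and u="\<lambda>t. \<theta> t - X (x t)" and M="M * K"
        and u'="\<lambda>t. x' t *\<^sub>R V (\<theta> t) - x' t *\<^sub>R V (X (x t))"])
    fix s assume s: "s \<in> {0..T}"
    have sub: "x ` {0..T} \<subseteq> {lo..hi}" using x_in by blast
    have "((X \<circ> x) has_vector_derivative x' s *\<^sub>R V (X (x s))) (at s within {0..T})"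
      using x[OF s] X[OF x_in[OF s]] sub
      by (intro vector_diff_chain_within)
        (auto simp: has_real_derivative_iff_has_vector_derivative
          intro: has_vector_derivative_within_subset)
    then show "((\<lambda>t. \<theta> t - X (x t)) has_vector_derivative
        x' s *\<^sub>R V (\<theta> s) - x' s *\<^sub>R V (X (x s))) (at s within {0..T})"
      unfolding o_def by (intro has_vector_derivative_diff \<theta> s)
    have "norm (x' s *\<^sub>R V (\<theta> s) - x' s *\<^sub>R V (X (x s))) = \<bar>x' s\<bar> * norm (V (\<theta> s) - V (X (x s)))"
      by (simp flip: scaleR_diff_right)
    also have "\<dots> \<le> M * (K * norm (\<theta> s - X (x s)))"
      using lipschitz_onD[OF V, of "\<theta> s" "X (x s)"] x'_bound[OF s]
      by (intro mult_mono) (auto simp: dist_norm)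
    finally show "norm (x' s *\<^sub>R V (\<theta> s) - x' s *\<^sub>R V (X (x s))) \<le> M * K * norm (\<theta> s - X (x s))"
      by (simp add: mult.assoc)
  qed (use init t in auto)
  then show ?thesis by simp
qed

text \<open>
  Inversion in the unit sphere, made Lipschitz on bounded sets by a cut-off of the denominator
  near the origin. Two terms arise from changing the numerator and the denominator in turn.
\<close>

lemma truncated_inversion_lipschitz:
  fixes u v :: "'a::real_inner"
  assumes \<mu>: "\<mu> > 0" and u: "norm u \<le> B" and v: "norm v \<le> B"
  shows "norm (u /\<^sub>R max (\<mu>\<^sup>2) ((norm u)\<^sup>2) - v /\<^sub>R max (\<mu>\<^sup>2) ((norm v)\<^sup>2))
    \<le> (1 / \<mu>\<^sup>2 + 2 * B\<^sup>2 / \<mu>^4) * norm (u - v)"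
proof -
  define \<rho> where "\<rho> w = max (\<mu>\<^sup>2) ((norm w)\<^sup>2)" for w :: 'a
  have \<rho>: "\<rho> w \<ge> \<mu>\<^sup>2" "\<rho> w > 0" for w using \<mu> by (auto simp: \<rho>_def less_max_iff_disj)
  have B: "B \<ge> 0" using u norm_ge_zero order_trans by blast
  have "\<bar>\<rho> v - \<rho> u\<bar> \<le> \<bar>(norm v)\<^sup>2 - (norm u)\<^sup>2\<bar>" unfolding \<rho>_def by linarith
  also have "\<dots> = \<bar>norm v - norm u\<bar> * (norm v + norm u)"
    by (simp add: power2_eq_square square_diff_square_factored abs_mult mult.commute)
  also have "\<dots> \<le> norm (u - v) * (2 * B)"
    using u v norm_triangle_ineq3[of v u] by (intro mult_mono) (auto simp: norm_minus_commute)
  finally have diff: "\<bar>\<rho> v - \<rho> u\<bar> \<le> norm (u - v) * (2 * B)" .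
  have "u /\<^sub>R \<rho> u - v /\<^sub>R \<rho> v = (u - v) /\<^sub>R \<rho> u + ((\<rho> v - \<rho> u) / (\<rho> u * \<rho> v)) *\<^sub>R v"
  proof -
    have "(\<rho> v - \<rho> u) / (\<rho> u * \<rho> v) = inverse (\<rho> u) - inverse (\<rho> v)"
      using \<rho>(2)[of u] \<rho>(2)[of v] by (simp add: field_simps)
    then show ?thesis by (simp add: scaleR_diff_left scaleR_diff_right)
  qed
  then have "norm (u /\<^sub>R \<rho> u - v /\<^sub>R \<rho> v)
      \<le> norm ((u - v) /\<^sub>R \<rho> u) + norm (((\<rho> v - \<rho> u) / (\<rho> u * \<rho> v)) *\<^sub>R v)"
    by (simp only: norm_triangle_ineq)
  also have "norm ((u - v) /\<^sub>R \<rho> u) = norm (u - v) / \<rho> u"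
    using \<rho>(2)[of u] by (simp add: divide_inverse)
  also have "\<dots> \<le> norm (u - v) / \<mu>\<^sup>2"
    using \<rho>[of u] \<mu> by (intro divide_left_mono) auto
  also have "norm (((\<rho> v - \<rho> u) / (\<rho> u * \<rho> v)) *\<^sub>R v) = (\<bar>\<rho> v - \<rho> u\<bar> * norm v) / (\<rho> u * \<rho> v)"
    using \<rho>(2)[of u] \<rho>(2)[of v] by (simp add: abs_mult)
  also have "\<dots> \<le> (norm (u - v) * (2 * B) * B) / (\<mu>\<^sup>2 * \<mu>\<^sup>2)"
    using \<rho>(1)[of u] \<rho>(1)[of v] \<mu> diff v B \<rho>(2)[of u] by (intro frac_le mult_mono) auto
  finally show ?thesis
    unfolding \<rho>_def by (simp add: algebra_simps power2_eq_square power4_eq_xxxx)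
qed

text \<open>
  Along the field \<open>gradient / |gradient|\<^sup>2\<close> the function \<open>f\<close> grows at unit speed. Near critical
  points the field blows up, but these stay away from the compact set \<open>f -` I\<close> of regular points, on
  which the gradient has a positive minimum. The fields \<open>V\<close> and \<open>\<rho>\<close> extend
  \<open>gradient / |gradient|\<^sup>2\<close> and \<open>|gradient|\<^sup>2\<close> from that set to the whole space with global
  bounds: points are first projected to a convex compact set \<open>C\<close> (a Lipschitz map), and the
  denominator is cut off below by the minimum of \<open>|gradient|\<^sup>2\<close>.
\<close>

lemma gradient_field_normalised:
  fixes S :: "'a::euclidean_space set"
  assumes S: "subspace S" and f: "C2_on S f" and proper: "proper_on S f"
    and I: "compact I" "I \<noteq> {}" and reg: "I \<subseteq> regular_values S f"
  obtains V \<rho> K \<mu> B where "K-lipschitz_on UNIV V" "continuous_on UNIV \<rho>" "\<mu> > 0" "B > 0"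
    "\<And>w. \<mu> \<le> \<rho> w" "\<And>w. \<rho> w \<le> B"
    "\<And>w. w \<in> S \<Longrightarrow> f w \<in> I \<Longrightarrow> \<rho> w = (norm (gradient_on S f w))\<^sup>2"
    "\<And>w. w \<in> S \<Longrightarrow> f w \<in> I \<Longrightarrow> V w = gradient_on S f w /\<^sub>R \<rho> w"
proof -
  let ?G = "gradient_on S f"
  define A where "A = {w \<in> S. f w \<in> I}"
  have A: "compact A" using proper I unfolding proper_on_def A_def by blast
  have A_ne: "A \<noteq> {}"
  proof -
    obtain c where "c \<in> I" using I(2) by blast
    then have "c \<in> f ` S" using reg unfolding regular_values_def by blast
    with \<open>c \<in> I\<close> show ?thesis unfolding A_def by blast
  qed
  obtain R where R: "A \<subseteq> cball 0 R"
    using compact_imp_bounded[OF A] by (auto simp: bounded_any_center[of _ 0] subset_eq)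
  define C where "C = S \<inter> cball 0 R"
  have C: "compact C" "convex C" "C \<subseteq> S" "A \<subseteq> C"
    unfolding C_def using R subspace_imp_convex[OF S] closed_subspace[OF S]
    by (auto simp: A_def intro!: closed_Int_compact convex_Int)
  have C_ne: "C \<noteq> {}" and C_cl: "closed C" using C A_ne compact_imp_closed by auto
  obtain K0 where K0: "K0-lipschitz_on C ?G" using gradient_on_lipschitz[OF S f C(1-3)] by blast
  have cont: "continuous_on C ?G" using K0 by (rule lipschitz_on_continuous_on)
  have "bounded (?G ` C)" using C(1) cont by (meson compact_continuous_image compact_imp_bounded)
  then obtain B where B: "B > 0" "\<And>w. w \<in> C \<Longrightarrow> norm (?G w) \<le> B" unfolding bounded_pos by auto
  have "continuous_on A (\<lambda>w. norm (?G w))"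
    using cont C(4) by (intro continuous_intros) (auto intro: continuous_on_subset)
  then obtain m where m: "m \<in> A" "\<And>w. w \<in> A \<Longrightarrow> norm (?G m) \<le> norm (?G w)"
    using continuous_attains_inf[OF A A_ne] by blast
  define \<mu> where "\<mu> = norm (?G m)"
  have "?G m \<noteq> 0" using m(1) reg unfolding A_def regular_values_def by blast
  then have \<mu>: "\<mu> > 0" by (simp add: \<mu>_def)
  have \<mu>B: "\<mu> \<le> B" unfolding \<mu>_def using B(2) m(1) C(4) by blast
  define \<pi> where "\<pi> = closest_point C"
  have \<pi>C: "\<pi> w \<in> C" for w unfolding \<pi>_def by (rule closest_point_in_set[OF C_cl C_ne])
  have \<pi>_id: "\<pi> w = w" if "w \<in> C" for w unfolding \<pi>_def by (rule closest_point_self[OF that])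
  have \<pi>_lip: "dist (\<pi> w) (\<pi> w') \<le> dist w w'" for w w'
    unfolding \<pi>_def by (rule closest_point_lipschitz[OF C(2) C_cl C_ne])
  define \<rho> where "\<rho> w = max (\<mu>\<^sup>2) ((norm (?G (\<pi> w)))\<^sup>2)" for w
  define V where "V w = ?G (\<pi> w) /\<^sub>R \<rho> w" for w
  define K where "K = 1 / \<mu>\<^sup>2 + 2 * B\<^sup>2 / \<mu>^4"
  have K: "K \<ge> 0" unfolding K_def by simp
  have K0_nn: "K0 \<ge> 0" using K0 by (rule lipschitz_on_nonneg)
  show thesis
  proof
    show "(K * K0)-lipschitz_on UNIV V"
    proof (rule lipschitz_onI)
      fix x y :: 'a
      have "dist (V x) (V y) \<le> K * norm (?G (\<pi> x) - ?G (\<pi> y))"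
        unfolding V_def \<rho>_def dist_norm K_def
        by (rule truncated_inversion_lipschitz[OF \<mu> B(2)[OF \<pi>C] B(2)[OF \<pi>C]])
      also have "\<dots> \<le> K * (K0 * dist (\<pi> x) (\<pi> y))"
        using lipschitz_onD[OF K0 \<pi>C \<pi>C, of x y] K by (intro mult_left_mono) (auto simp: dist_norm)
      also have "\<dots> \<le> K * (K0 * dist x y)" by (intro mult_left_mono \<pi>_lip K K0_nn)
      finally show "dist (V x) (V y) \<le> K * K0 * dist x y" by (simp add: mult.assoc)
    qed (use K K0_nn in simp)
    have "continuous_on UNIV \<pi>"
      unfolding \<pi>_def by (rule continuous_on_closest_point[OF C(2) C_cl C_ne])
    then have "continuous_on UNIV (\<lambda>w. ?G (\<pi> w))"
      by (rule continuous_on_compose2[OF cont]) (use \<pi>C in auto)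
    then show "continuous_on UNIV \<rho>"
      unfolding \<rho>_def by (intro continuous_intros)
    show "\<mu>\<^sup>2 > 0" "B\<^sup>2 > 0" using \<mu> B(1) by auto
    show "\<mu>\<^sup>2 \<le> \<rho> w" for w by (simp add: \<rho>_def)
    show "\<rho> w \<le> B\<^sup>2" for w
      using \<mu>B \<mu> B(2)[OF \<pi>C[of w]] by (simp add: \<rho>_def power_mono)
    fix w assume "w \<in> S" "f w \<in> I"
    then have w: "w \<in> A" "\<pi> w = w" using C(4) \<pi>_id by (auto simp: A_def)
    have "\<mu>\<^sup>2 \<le> (norm (?G w))\<^sup>2" using m(2)[OF w(1)] \<mu> by (intro power_mono) (auto simp: \<mu>_def)
    then show "\<rho> w = (norm (?G w))\<^sup>2" by (simp add: \<rho>_def w(2))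
    show "V w = ?G w /\<^sub>R \<rho> w" by (simp add: V_def w(2))
  qed
qed

text \<open>
  The key lemma. While \<open>f \<theta>\<close> stays near \<open>p\<close>, a trajectory \<open>\<theta>' = a t *\<^sub>R gradient\<close>
  runs on one integral curve \<open>X\<close> of the normalised gradient field, so that \<open>|gradient|\<^sup>2\<close> is a
  function \<open>\<rho> (X z)\<close> of the value \<open>z = f \<theta>\<close> alone. As \<open>z' = a * \<rho> (X z)\<close>, the integral \<open>h\<close> of
  \<open>(z - p) / \<rho> (X z)\<close> from \<open>p\<close> has the time derivative \<open>a * (z - p)\<close>: the unknown factor \<open>\<rho>\<close> has
  disappeared. The curve, and with it \<open>h\<close>, depends on the trajectory, but the width \<open>\<eta>\<close> and the
  bounds \<open>\<alpha>\<close> and \<open>\<beta>\<close> come from the bounds of \<open>\<rho>\<close> and the Lipschitz constant of the field, which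
  do not.
\<close>

lemma coordinate_energy:
  fixes S :: "'a::euclidean_space set" and p :: real
  assumes S: "subspace S" and f: "C2_on S f" and proper: "proper_on S f"
    and \<xi>: "\<xi> > 0" and reg: "{p - \<xi>..p + \<xi>} \<subseteq> regular_values S f"
  shows "\<exists>\<eta>>0. \<exists>\<alpha>>0. \<exists>\<beta>>0. \<forall>T \<theta> a.
    (\<forall>t\<in>{0..T}. \<theta> t \<in> S \<and> \<bar>f (\<theta> t) - p\<bar> \<le> \<eta> \<and>
       (\<theta> has_vector_derivative a t *\<^sub>R gradient_on S f (\<theta> t)) (at t within {0..T})) \<and>
    continuous_on {0..T} a \<longrightarrow>
    (\<exists>H. \<forall>t\<in>{0..T}. (H has_real_derivative a t * (f (\<theta> t) - p)) (at t within {0..T}) \<and>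
       \<alpha> * (f (\<theta> t) - p)\<^sup>2 \<le> H t \<and> H t \<le> \<beta> * (f (\<theta> t) - p)\<^sup>2)"
proof -
  let ?G = "gradient_on S f"
  obtain V \<rho> K \<mu> B where V: "K-lipschitz_on UNIV V" and \<rho>_cont: "continuous_on UNIV \<rho>"
    and \<mu>: "\<mu> > 0" and B: "B > 0" and \<rho>: "\<And>w. \<mu> \<le> \<rho> w" "\<And>w. \<rho> w \<le> B"
    and \<rho>_eq: "\<And>w. w \<in> S \<Longrightarrow> f w \<in> {p - \<xi>..p + \<xi>} \<Longrightarrow> \<rho> w = (norm (?G w))\<^sup>2"
    and V_eq: "\<And>w. w \<in> S \<Longrightarrow> f w \<in> {p - \<xi>..p + \<xi>} \<Longrightarrow> V w = ?G w /\<^sub>R \<rho> w"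
    by (rule gradient_field_normalised[OF S f proper _ _ reg]) (use \<xi> in auto)
  have K: "K \<ge> 0" using V by (rule lipschitz_on_nonneg)
  have \<rho>_pos: "\<rho> w > 0" for w using \<mu> \<rho>(1)[of w] by linarith
  have \<rho>_nz: "\<rho> w \<noteq> 0" for w using \<rho>_pos[of w] by simp
  \<comment> \<open>narrow enough for one application of the contraction argument\<close>
  define \<eta> where "\<eta> = min \<xi> (1 / (4 * (K + 1)))"
  have \<eta>: "\<eta> > 0" "\<eta> \<le> \<xi>" using \<xi> K by (auto simp: \<eta>_def)
  define lo hi where "lo = p - \<eta>" and "hi = p + \<eta>"
  have "K * (hi - lo) = 2 * (K * \<eta>)" by (simp add: lo_def hi_def)
  also have "\<dots> \<le> 2 * (K * (1 / (4 * (K + 1))))" using K by (intro mult_left_mono) (auto simp: \<eta>_def)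
  also have "\<dots> \<le> 1/2" using K by (simp add: field_simps)
  finally have short: "K * (hi - lo) \<le> 1/2" .
  have p_in: "p \<in> {lo..hi}" using \<eta> by (simp add: lo_def hi_def)
  have "\<exists>H. \<forall>t\<in>{0..T}. (H has_real_derivative a t * (f (\<theta> t) - p)) (at t within {0..T}) \<and>
       1 / (2 * B) * (f (\<theta> t) - p)\<^sup>2 \<le> H t \<and> H t \<le> 1 / (2 * \<mu>) * (f (\<theta> t) - p)\<^sup>2"
    if hyp: "\<forall>t\<in>{0..T}. \<theta> t \<in> S \<and> \<bar>f (\<theta> t) - p\<bar> \<le> \<eta> \<and>
       (\<theta> has_vector_derivative a t *\<^sub>R ?G (\<theta> t)) (at t within {0..T})"
      and a: "continuous_on {0..T} a" for T \<theta> a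
  proof (cases "T \<ge> 0")
    case True
    define x where "x t = f (\<theta> t)" for t
    define x' where "x' t = a t * \<rho> (\<theta> t)" for t
    have \<theta>S: "\<theta> t \<in> S" and x_in: "x t \<in> {lo..hi}" and x_in': "f (\<theta> t) \<in> {p - \<xi>..p + \<xi>}"
      and \<theta>': "(\<theta> has_vector_derivative a t *\<^sub>R ?G (\<theta> t)) (at t within {0..T})"
      if "t \<in> {0..T}" for t
      using hyp that \<eta> by (fastforce simp: x_def lo_def hi_def abs_le_iff)+
    have x: "(x has_real_derivative x' t) (at t within {0..T})" if t: "t \<in> {0..T}" for t
    proof -
      have "(f has_derivative (\<lambda>h. ?G (\<theta> t) \<bullet> h)) (at (\<theta> t) within \<theta> ` {0..T})"
        by (rule has_derivative_subset[OF has_derivative_gradient_on[OF S f \<theta>S[OF t]]])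
          (use \<theta>S in auto)
      from vector_derivative_diff_chain_within[OF \<theta>'[OF t] this]
      show ?thesis
        unfolding has_real_derivative_iff_has_vector_derivative x_def[abs_def] x'_def
        by (simp add: o_def \<rho>_eq[OF \<theta>S[OF t] x_in'[OF t]] dot_square_norm)
    qed
    have "bounded (a ` {0..T})"
      using a compact_Icc by (meson compact_continuous_image compact_imp_bounded)
    then obtain M where M: "M > 0" "\<And>t. t \<in> {0..T} \<Longrightarrow> \<bar>a t\<bar> \<le> M" unfolding bounded_pos by auto
    obtain X where X0: "X (x 0) = \<theta> 0"
      and X: "\<And>z. z \<in> {lo..hi} \<Longrightarrow> (X has_vector_derivative V (X z)) (at z within {lo..hi})"
      using picard_lindelof_short_interval[OF V x_in[of 0] short, of "\<theta> 0"] True by auto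
    have \<theta>X: "\<theta> t = X (x t)" if t: "t \<in> {0..T}" for t
    proof (rule time_change_unique[where T=T and X=X and V=V and \<theta>=\<theta> and x=x and x'=x' and M="M * B", OF V X x x_in _ _ X0 t])
      fix s assume s: "s \<in> {0..T}"
      show "\<bar>x' s\<bar> \<le> M * B"
        unfolding x'_def abs_mult
        using M s \<rho>(2)[of "\<theta> s"] \<rho>_pos[of "\<theta> s"] by (intro mult_mono) auto
      have "x' s *\<^sub>R V (\<theta> s) = a s *\<^sub>R ?G (\<theta> s)"
        using V_eq[OF \<theta>S[OF s] x_in'[OF s]] \<rho>_pos[of "\<theta> s"] by (simp add: x'_def)
      then show "(\<theta> has_vector_derivative x' s *\<^sub>R V (\<theta> s)) (at s within {0..T})"
        using \<theta>'[OF s] by simp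
    qed auto
    have "continuous_on {lo..hi} X" by (rule continuous_on_vector_derivative[OF X])
    then have "continuous_on {lo..hi} (\<lambda>z. \<rho> (X z))"
      by (rule continuous_on_compose2[OF \<rho>_cont]) auto
    then have "continuous_on {lo..hi} (\<lambda>z. (z - p) / \<rho> (X z))"
      using \<rho>_nz by (intro continuous_intros) auto
    then obtain h0 where h0: "\<And>z. z \<in> {lo..hi} \<Longrightarrow>
        (h0 has_vector_derivative (z - p) / \<rho> (X z)) (at z within {lo..hi})"
      using antiderivative_continuous by blast
    define h where "h z = h0 z - h0 p" for z
    have h: "(h has_real_derivative (z - p) / \<rho> (X z)) (at z within {lo..hi})" if "z \<in> {lo..hi}" for z
      unfolding h_def has_real_derivative_iff_has_vector_derivative
      by (auto intro!: derivative_eq_intros h0 that)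
    have lower: "1 / (2 * B) * (z - p)\<^sup>2 \<le> h z" if z: "z \<in> {lo..hi}" for z
    proof -
      have "0 \<le> h z - (z - p)\<^sup>2 / (2 * B)"
      proof (rule nonneg_of_derivative_sign[where e="\<lambda>z. 1 / \<rho> (X z) - 1 / B" and p=p, OF _ _ p_in _ z])
        fix y assume y: "y \<in> {lo..hi}"
        show "((\<lambda>z. h z - (z - p)\<^sup>2 / (2 * B)) has_real_derivative (y - p) * (1 / \<rho> (X y) - 1 / B))
            (at y within {lo..hi})"
          using B by (auto intro!: derivative_eq_intros h[OF y] simp: field_simps)
        show "0 \<le> 1 / \<rho> (X y) - 1 / B"
          using \<rho>(2)[of "X y"] \<rho>_pos[of "X y"] by (simp add: frac_le)
      qed (simp add: h_def)
      then show ?thesis by simp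
    qed
    have upper: "h z \<le> 1 / (2 * \<mu>) * (z - p)\<^sup>2" if z: "z \<in> {lo..hi}" for z
    proof -
      have "0 \<le> (z - p)\<^sup>2 / (2 * \<mu>) - h z"
      proof (rule nonneg_of_derivative_sign[where e="\<lambda>z. 1 / \<mu> - 1 / \<rho> (X z)" and p=p, OF _ _ p_in _ z])
        fix y assume y: "y \<in> {lo..hi}"
        show "((\<lambda>z. (z - p)\<^sup>2 / (2 * \<mu>) - h z) has_real_derivative (y - p) * (1 / \<mu> - 1 / \<rho> (X y)))
            (at y within {lo..hi})"
          using \<mu> by (auto intro!: derivative_eq_intros h[OF y] simp: field_simps)
        show "0 \<le> 1 / \<mu> - 1 / \<rho> (X y)"
          using \<rho>(1)[of "X y"] \<mu> by (simp add: frac_le)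
      qed (simp add: h_def)
      then show ?thesis by simp
    qed
    show ?thesis
    proof (intro exI[of _ "\<lambda>t. h (x t)"] ballI conjI)
      fix t assume t: "t \<in> {0..T}"
      have "(h has_real_derivative (x t - p) / \<rho> (X (x t))) (at (x t) within x ` {0..T})"
        by (rule DERIV_subset[OF h[OF x_in[OF t]]]) (use x_in in auto)
      from DERIV_image_chain[OF this x[OF t]]
      show "((\<lambda>t. h (x t)) has_real_derivative a t * (f (\<theta> t) - p)) (at t within {0..T})"
        using \<theta>X[OF t, symmetric] \<rho>_nz[of "\<theta> t"] by (simp add: o_def x'_def x_def[of t] mult.commute)
    qed (use lower upper x_in in \<open>auto simp: x_def\<close>)
  qed auto
  then show ?thesis using \<eta>(1) \<mu> B
    by (intro exI[of _ \<eta>] exI[of _ "1 / (2 * B)"] exI[of _ "1 / (2 * \<mu>)"] conjI allI impI) auto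
qed

section \<open>The energy of one player\<close>

lemma subspace_block_space: "subspace (block_space b i)"
  unfolding block_space_def subspace_def by auto

lemma block_in_block_space: "block b i \<theta> \<in> block_space b i"
  unfolding block_space_def block_def by auto

lemma continuous_on_hidden_map:
  assumes f: "\<And>i. C2_on (block_space b i) (f i)"
    and \<theta>: "\<And>i. continuous_on J (\<lambda>t. block b i (\<theta> t))"
  shows "continuous_on J (\<lambda>t. hidden_map b f (\<theta> t))"
  unfolding hidden_map_def
proof (rule continuous_on_vec_lambda)
  fix i
  have "continuous_on (block_space b i) (f i)"
    by (rule has_derivative_continuous_on)
      (rule has_derivative_gradient_on[OF subspace_block_space f])
  then show "continuous_on J (\<lambda>t. f i (block b i (\<theta> t)))"
    by (rule continuous_on_compose2[OF _ \<theta>]) (auto simp: block_in_block_space)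
qed

text \<open>
  The dynamics of either player, with the partial derivatives of \<open>L\<close> regarded as given signals \<open>a\<close>:
  this makes the two players instances of the same notion.
\<close>

definition driven_flow ::
  "('k::finite \<Rightarrow> 'n::finite) \<Rightarrow> ('n \<Rightarrow> real^'k \<Rightarrow> real) \<Rightarrow>
   real \<Rightarrow> ('n \<Rightarrow> real \<Rightarrow> real) \<Rightarrow> (real \<Rightarrow> real^'k) \<Rightarrow> bool" where
  "driven_flow b f T a \<theta> \<longleftrightarrow>
    (\<forall>i. continuous_on {0..T} (a i)) \<and>
    (\<forall>t\<in>{0..T}. \<forall>i. ((\<lambda>s. block b i (\<theta> s)) has_vector_derivative
       a i t *\<^sub>R gradient_on (block_space b i) (f i) (block b i (\<theta> t))) (at t within {0..T}))"

text \<open>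
  A Lyapunov function enters only through its values along the trajectory. So \<open>H\<close> is a function
  of time, and it may differ from one trajectory to the next.
\<close>

definition quadratic_energy ::
  "real \<Rightarrow> ('n::finite \<Rightarrow> real \<Rightarrow> real) \<Rightarrow> (real \<Rightarrow> real^'n) \<Rightarrow> real \<Rightarrow> real \<Rightarrow> (real \<Rightarrow> real) \<Rightarrow> bool" where
  "quadratic_energy T a v \<alpha> \<beta> H \<longleftrightarrow> (\<forall>t\<in>{0..T}.
     (H has_real_derivative (\<Sum>i\<in>UNIV. a i t * v t $ i)) (at t within {0..T}) \<and>
     \<alpha> * (norm (v t))\<^sup>2 \<le> H t \<and> H t \<le> \<beta> * (norm (v t))\<^sup>2)"

text \<open>
  The sum of the energies of the coordinates. The least width and the extreme bounds
  serve all of the finitely many coordinates.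
\<close>

lemma player_energy:
  fixes b :: "'k::finite \<Rightarrow> 'n::finite" and f :: "'n \<Rightarrow> real^'k \<Rightarrow> real" and p :: "real^'n"
  assumes f: "\<And>i. C2_on (block_space b i) (f i)"
    and proper: "\<And>i. proper_on (block_space b i) (f i)"
    and \<xi>: "\<xi> > 0"
    and reg: "\<And>i. {p $ i - \<xi>..p $ i + \<xi>} \<subseteq> regular_values (block_space b i) (f i)"
  obtains \<eta> \<alpha> \<beta> where "\<eta> > 0" "\<alpha> > 0" "\<beta> > 0"
    and "\<And>T a \<theta>. driven_flow b f T a \<theta> \<Longrightarrow>
      \<forall>t\<in>{0..T}. norm (hidden_map b f (\<theta> t) - p) \<le> \<eta> \<Longrightarrow>
      \<exists>H. quadratic_energy T a (\<lambda>t. hidden_map b f (\<theta> t) - p) \<alpha> \<beta> H"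
proof -
  have "\<forall>i. \<exists>\<eta> \<alpha> \<beta>. \<eta> > 0 \<and> \<alpha> > 0 \<and> \<beta> > 0 \<and> (\<forall>T \<theta> a.
    (\<forall>t\<in>{0..T}. \<theta> t \<in> block_space b i \<and> \<bar>f i (\<theta> t) - p $ i\<bar> \<le> \<eta> \<and>
       (\<theta> has_vector_derivative a t *\<^sub>R gradient_on (block_space b i) (f i) (\<theta> t)) (at t within {0..T})) \<and>
    continuous_on {0..T} a \<longrightarrow>
    (\<exists>H. \<forall>t\<in>{0..T}. (H has_real_derivative a t * (f i (\<theta> t) - p $ i)) (at t within {0..T}) \<and>
       \<alpha> * (f i (\<theta> t) - p $ i)\<^sup>2 \<le> H t \<and> H t \<le> \<beta> * (f i (\<theta> t) - p $ i)\<^sup>2))"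
    using coordinate_energy[OF subspace_block_space f proper \<xi> reg] by blast
  then obtain \<eta> \<alpha> \<beta> :: "'n \<Rightarrow> real"
    where pos: "\<And>i. \<eta> i > 0" "\<And>i. \<alpha> i > 0" "\<And>i. \<beta> i > 0"
    and energy: "\<And>i T \<theta> a.
      (\<forall>t\<in>{0..T}. \<theta> t \<in> block_space b i \<and> \<bar>f i (\<theta> t) - p $ i\<bar> \<le> \<eta> i \<and>
         (\<theta> has_vector_derivative a t *\<^sub>R gradient_on (block_space b i) (f i) (\<theta> t)) (at t within {0..T})) \<Longrightarrow>
      continuous_on {0..T} a \<Longrightarrow>
      (\<exists>H. \<forall>t\<in>{0..T}. (H has_real_derivative a t * (f i (\<theta> t) - p $ i)) (at t within {0..T}) \<and>
         \<alpha> i * (f i (\<theta> t) - p $ i)\<^sup>2 \<le> H t \<and> H t \<le> \<beta> i * (f i (\<theta> t) - p $ i)\<^sup>2)"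
    by metis
  define \<eta>0 \<alpha>0 \<beta>0 where "\<eta>0 = Min (range \<eta>)" and "\<alpha>0 = Min (range \<alpha>)" and "\<beta>0 = Max (range \<beta>)"
  have le: "\<eta>0 \<le> \<eta> i" "\<alpha>0 \<le> \<alpha> i" "\<beta> i \<le> \<beta>0" for i
    by (auto simp: \<eta>0_def \<alpha>0_def \<beta>0_def)
  have pos0: "\<eta>0 > 0" "\<alpha>0 > 0"
    using pos by (auto simp: \<eta>0_def \<alpha>0_def)
  have "\<beta>0 > 0" using pos(3) le(3) less_le_trans by blast
  have "\<exists>H. quadratic_energy T a (\<lambda>t. hidden_map b f (\<theta> t) - p) \<alpha>0 \<beta>0 H"
    if flow: "driven_flow b f T a \<theta>"
      and near: "\<forall>t\<in>{0..T}. norm (hidden_map b f (\<theta> t) - p) \<le> \<eta>0"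
    for T and a :: "'n \<Rightarrow> real \<Rightarrow> real" and \<theta> :: "real \<Rightarrow> real^'k"
  proof -
    let ?x = "\<lambda>t. hidden_map b f (\<theta> t)"
    have x_i: "f i (block b i (\<theta> t)) - p $ i = (?x t - p) $ i" for i t
      by (simp add: hidden_map_def)
    have "\<exists>H. \<forall>t\<in>{0..T}. (H has_real_derivative a i t * (?x t - p) $ i) (at t within {0..T}) \<and>
         \<alpha> i * ((?x t - p) $ i)\<^sup>2 \<le> H t \<and> H t \<le> \<beta> i * ((?x t - p) $ i)\<^sup>2" for i
    proof -
      have "\<bar>(?x t - p) $ i\<bar> \<le> \<eta> i" if "t \<in> {0..T}" for t
        using component_le_norm_cart[of "?x t - p" i] bspec[OF near that] le(1)[of i] by linarith
      then show ?thesis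
        using energy[of T "\<lambda>t. block b i (\<theta> t)" i "a i"] flow
        by (simp add: driven_flow_def block_in_block_space x_i)
    qed
    then obtain H where H: "\<And>i t. t \<in> {0..T} \<Longrightarrow>
        (H i has_real_derivative a i t * (?x t - p) $ i) (at t within {0..T})"
      and H_bounds: "\<And>i t. t \<in> {0..T} \<Longrightarrow>
        \<alpha> i * ((?x t - p) $ i)\<^sup>2 \<le> H i t \<and> H i t \<le> \<beta> i * ((?x t - p) $ i)\<^sup>2"
      by metis
    have norm: "(norm v)\<^sup>2 = (\<Sum>i\<in>UNIV. (v $ i)\<^sup>2)" for v :: "real^'n"
      by (simp add: norm_vec_def L2_set_def sum_nonneg)
    show ?thesis
      unfolding quadratic_energy_def
    proof (intro exI[of _ "\<lambda>t. \<Sum>i\<in>UNIV. H i t"] ballI conjI)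
      fix t assume t: "t \<in> {0..T}"
      show "((\<lambda>t. \<Sum>i\<in>UNIV. H i t) has_real_derivative (\<Sum>i\<in>UNIV. a i t * (?x t - p) $ i))
          (at t within {0..T})"
        by (rule DERIV_sum) (rule H[OF t])
      show "\<alpha>0 * (norm (?x t - p))\<^sup>2 \<le> (\<Sum>i\<in>UNIV. H i t)"
        unfolding norm sum_distrib_left
        by (rule sum_mono)
          (meson H_bounds[OF t] le(2) mult_right_mono order_trans zero_le_power2)
      show "(\<Sum>i\<in>UNIV. H i t) \<le> \<beta>0 * (norm (?x t - p))\<^sup>2"
        unfolding norm sum_distrib_left
        by (rule sum_mono)
          (meson H_bounds[OF t] le(3) mult_right_mono order_trans zero_le_power2)
    qed
  qed
  with pos0 \<open>\<beta>0 > 0\<close> show thesis by (rule that)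
qed

section \<open>Convex-concave functions near an equilibrium\<close>

text \<open>
  The one-dimensional tangent inequality, on the line from \<open>x\<close> to \<open>z\<close>.
\<close>

lemma convex_on_above_tangent_vector:
  fixes \<phi> :: "'a::real_normed_vector \<Rightarrow> real"
  assumes conv: "convex_on UNIV \<phi>" and der: "(\<phi> has_derivative D) (at x)"
  shows "D (z - x) \<le> \<phi> z - \<phi> x"
proof -
  define \<psi> where "\<psi> s = \<phi> (x + s *\<^sub>R (z - x))" for s :: real
  have "convex_on UNIV \<psi>"
  proof (rule convex_onI)
    fix t r s :: real assume t: "0 < t" "t < 1"
    have "x + ((1 - t) *\<^sub>R r + t *\<^sub>R s) *\<^sub>R (z - x) =
        (1 - t) *\<^sub>R (x + r *\<^sub>R (z - x)) + t *\<^sub>R (x + s *\<^sub>R (z - x))"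
      by (simp add: algebra_simps)
    then show "\<psi> ((1 - t) *\<^sub>R r + t *\<^sub>R s) \<le> (1 - t) * \<psi> r + t * \<psi> s"
      using convex_onD[OF conv, of t "x + r *\<^sub>R (z - x)" "x + s *\<^sub>R (z - x)"] t
      by (simp add: \<psi>_def)
  qed simp
  moreover have "(\<psi> has_real_derivative D (z - x)) (at 0)"
  proof -
    have g: "((\<lambda>s::real. x + s *\<^sub>R (z - x)) has_derivative (\<lambda>h. h *\<^sub>R (z - x))) (at 0)"
      by (auto intro!: derivative_eq_intros)
    have "(\<phi> has_derivative D) (at (x + 0 *\<^sub>R (z - x)))" using der by simp
    from has_derivative_compose[OF g this] show ?thesis
      using linear_cmul[OF has_derivative_linear[OF der]]
      by (simp add: \<psi>_def[abs_def] has_field_derivative_def mult_commute_abs)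
  qed
  ultimately have "\<psi> 1 - \<psi> 0 \<ge> D (z - x) * (1 - 0)"
    by (intro convex_on_imp_above_tangent[of UNIV]) auto
  then show ?thesis by (simp add: \<psi>_def)
qed

text \<open>
  This is the rate of change of the total energy. The tangent inequalities for \<open>L (\<cdot>, y)\<close> and
  \<open>- L (x, \<cdot>)\<close> bound it by \<open>L (p, y) - L (x, q)\<close>: the value \<open>L (x, y)\<close>
  cancels, and \<open>L (p, q)\<close> lies between the two values that remain.
\<close>

lemma saddle_monotonicity:
  fixes L :: "'a::real_normed_vector \<times> 'b::real_normed_vector \<Rightarrow> real"
  assumes cc: "convex_concave L" and sol: "(p, q) \<in> Solution L"
    and der: "(L has_derivative D) (at (x, y))"
  shows "D (p - x, 0) + D (0, y - q) \<le> 0"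
proof -
  have lin: "linear D" using der by (rule has_derivative_linear)
  have "((\<lambda>x. L (x, y)) has_derivative (\<lambda>h. D (h, 0))) (at x)"
    by (rule has_derivative_compose[of "\<lambda>x. (x, y)" _ x UNIV L D])
      (auto intro!: derivative_eq_intros der)
  then have 1: "D (p - x, 0) \<le> L (p, y) - L (x, y)"
    using cc by (intro convex_on_above_tangent_vector[where \<phi>="\<lambda>x. L (x, y)" and D="\<lambda>h. D (h, 0)"])
      (auto simp: convex_concave_def)
  have "((\<lambda>y. L (x, y)) has_derivative (\<lambda>h. D (0, h))) (at y)"
    by (rule has_derivative_compose[of "\<lambda>y. (x, y)" _ y UNIV L D])
      (auto intro!: derivative_eq_intros der)
  then have "((\<lambda>y. - L (x, y)) has_derivative (\<lambda>h. - D (0, h))) (at y)"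
    by (rule has_derivative_minus)
  then have 2: "- D (0, q - y) \<le> - L (x, q) - - L (x, y)"
    using cc by (intro convex_on_above_tangent_vector[where \<phi>="\<lambda>y. - L (x, y)" and D="\<lambda>h. - D (0, h)"])
      (auto simp: convex_concave_def concave_on_def)
  have 3: "- D (0, q - y) = D (0, y - q)" using linear_neg[OF lin, of "(0, q - y)"] by simp
  have "L (p, y) \<le> L (p, q)" "L (p, q) \<le> L (x, q)" using sol by (auto simp: Solution_def)
  then show ?thesis using 1 2 3 by linarith
qed

lemma partial_x_eq:
  assumes "(L has_derivative D) (at (x, y))"
  shows "partial_x L i x y = D (axis i 1, 0)"
proof -
  have g: "((\<lambda>s::real. (x + s *\<^sub>R axis i 1, y)) has_derivative (\<lambda>h. (h *\<^sub>R axis i 1, 0))) (at 0)"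
    by (auto intro!: derivative_eq_intros)
  have "(L has_derivative D) (at (x + 0 *\<^sub>R axis i 1, y))" using assms by simp
  from has_derivative_compose[OF g this]
  have "((\<lambda>s. L (x + s *\<^sub>R axis i 1, y)) has_real_derivative D (axis i 1, 0)) (at 0)"
    using linear_cmul[OF has_derivative_linear[OF assms], of _ "(axis i 1, 0)"]
    by (simp add: has_field_derivative_def mult_commute_abs)
  then show ?thesis unfolding partial_x_def by (rule DERIV_imp_deriv)
qed

lemma partial_y_eq:
  assumes "(L has_derivative D) (at (x, y))"
  shows "partial_y L j x y = D (0, axis j 1)"
proof -
  have g: "((\<lambda>s::real. (x, y + s *\<^sub>R axis j 1)) has_derivative (\<lambda>h. (0, h *\<^sub>R axis j 1))) (at 0)"
    by (auto intro!: derivative_eq_intros)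
  have "(L has_derivative D) (at (x, y + 0 *\<^sub>R axis j 1))" using assms by simp
  from has_derivative_compose[OF g this]
  have "((\<lambda>s. L (x, y + s *\<^sub>R axis j 1)) has_real_derivative D (0, axis j 1)) (at 0)"
    using linear_cmul[OF has_derivative_linear[OF assms], of _ "(0, axis j 1)"]
    by (simp add: has_field_derivative_def mult_commute_abs)
  then show ?thesis unfolding partial_y_def by (rule DERIV_imp_deriv)
qed

lemma linear_axis_sum:
  fixes l :: "real^'n::finite \<Rightarrow> real"
  assumes "linear l"
  shows "(\<Sum>i\<in>UNIV. l (axis i 1) * v $ i) = l v"
proof -
  have "l v = l (\<Sum>i\<in>UNIV. v $ i *\<^sub>R axis i 1)"
    using basis_expansion[of v] by (simp add: scalar_mult_eq_scaleR)
  also have "\<dots> = (\<Sum>i\<in>UNIV. l (axis i 1) * v $ i)"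
    by (simp add: linear_sum[OF assms] linear_cmul[OF assms] mult.commute)
  finally show ?thesis by simp
qed

section \<open>Stability\<close>

lemma first_hitting_time:
  fixes r :: "real \<Rightarrow> real"
  assumes cont: "continuous_on {0..t1} r" and "0 \<le> t1" "r 0 < \<kappa>" "\<kappa> \<le> r t1"
  obtains T where "T \<in> {0..t1}" "r T = \<kappa>" "\<And>t. t \<in> {0..T} \<Longrightarrow> r t \<le> \<kappa>"
proof -
  define A where "A = {t \<in> {0..t1}. r t = \<kappa>}"
  have "A = {0..t1} \<inter> r -` {\<kappa>}" by (auto simp: A_def)
  then have "closed A" using continuous_closed_preimage[OF cont, of "{\<kappa>}"] by simp
  moreover have "bounded A" unfolding A_def by (rule bounded_subset[of "{0..t1}"]) auto
  ultimately have compact: "compact A" by (simp add: compact_eq_bounded_closed)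
  have "A \<noteq> {}" using IVT'[of r 0 \<kappa> t1] assms by (auto simp: A_def)
  from compact_attains_inf[OF compact this]
  obtain T where T: "T \<in> A" "\<And>t. t \<in> A \<Longrightarrow> T \<le> t" by blast
  have "r t \<le> \<kappa>" if t: "t \<in> {0..T}" for t
  proof (rule ccontr)
    assume less: "\<not> r t \<le> \<kappa>"
    have "\<exists>s\<ge>0. s \<le> t \<and> r s = \<kappa>"
      using less assms T(1) t
      by (intro IVT') (auto simp: A_def intro: continuous_on_subset[OF cont])
    then obtain s where s: "0 \<le> s" "s \<le> t" "r s = \<kappa>" by blast
    then have "s \<in> A" using t T(1) by (auto simp: A_def)
    from T(2)[OF this] s t have "t = s" by simp
    with s less show False by simp
  qed
  then show thesis using that[of T] T(1) by (simp add: A_def)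
qed

theorem theorem4:
  fixes b :: "'k::finite \<Rightarrow> 'n::finite" and c :: "'l::finite \<Rightarrow> 'm::finite"
    and f :: "'n \<Rightarrow> real^'k \<Rightarrow> real" and g :: "'m \<Rightarrow> real^'l \<Rightarrow> real"
    and L :: "(real^'n) \<times> (real^'m) \<Rightarrow> real"
    and p :: "real^'n" and q :: "real^'m" and \<xi> \<epsilon> :: real
  assumes "surj b" and "surj c"
    and "\<And>i. C2_on (block_space b i) (f i)"
    and "\<And>j. C2_on (block_space c j) (g j)"
    and "C2_on UNIV L"
    and "convex_concave L"
    and "(p, q) \<in> Solution L"
    and "\<xi> > 0"
    and "\<And>i. {p $ i - \<xi> .. p $ i + \<xi>} \<subseteq> regular_values (block_space b i) (f i)"
    and "\<And>j. {q $ j - \<xi> .. q $ j + \<xi>} \<subseteq> regular_values (block_space c j) (g j)"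
    and "\<And>i. proper_on (block_space b i) (f i)"
    and "\<And>j. proper_on (block_space c j) (g j)"
    and "\<epsilon> > 0"
  shows "\<exists>\<delta>>0. \<forall>J \<theta> \<phi>. is_interval J \<and> 0 \<in> J \<and> J \<subseteq> {0..} \<and> gda_solution b c f g L J \<theta> \<phi> \<longrightarrow>
    (let r = (\<lambda>t. (norm (hidden_map b f (\<theta> t) - p))\<^sup>2 + (norm (hidden_map c g (\<phi> t) - q))\<^sup>2)
     in r 0 < \<delta> \<longrightarrow> (\<forall>t\<in>J. r t < \<epsilon>))"
proof -
  obtain L' :: "(real^'n) \<times> (real^'m) \<Rightarrow> ((real^'n) \<times> (real^'m)) \<Rightarrow>\<^sub>L real" and L''
    where L': "\<And>z. (L has_derivative blinfun_apply (L' z)) (at z)"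
      and L'': "\<And>z. (L' has_derivative blinfun_apply (L'' z)) (at z)"
    using \<open>C2_on UNIV L\<close> unfolding C2_on_def by auto
  have L'_cont: "continuous_on UNIV L'"
    by (rule has_derivative_continuous_on[of UNIV L' "\<lambda>z. blinfun_apply (L'' z)"]) (simp add: L'')
  obtain \<eta>1 \<alpha>1 \<beta>1 where pos1: "\<eta>1 > 0" "\<alpha>1 > 0" "\<beta>1 > 0"
    and energy1: "\<And>T a \<theta>. driven_flow b f T a \<theta> \<Longrightarrow>
      \<forall>t\<in>{0..T}. norm (hidden_map b f (\<theta> t) - p) \<le> \<eta>1 \<Longrightarrow>
      \<exists>H. quadratic_energy T a (\<lambda>t. hidden_map b f (\<theta> t) - p) \<alpha>1 \<beta>1 H"
    by (rule player_energy[of b f \<xi> p, OF assms(3) assms(11) assms(8) assms(9)]) (rule that)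
  obtain \<eta>2 \<alpha>2 \<beta>2 where pos2: "\<eta>2 > 0" "\<alpha>2 > 0" "\<beta>2 > 0"
    and energy2: "\<And>T a \<phi>. driven_flow c g T a \<phi> \<Longrightarrow>
      \<forall>t\<in>{0..T}. norm (hidden_map c g (\<phi> t) - q) \<le> \<eta>2 \<Longrightarrow>
      \<exists>H. quadratic_energy T a (\<lambda>t. hidden_map c g (\<phi> t) - q) \<alpha>2 \<beta>2 H"
    by (rule player_energy[of c g \<xi> q, OF assms(4) assms(12) assms(8) assms(10)]) (rule that)
  define \<alpha> \<beta> where "\<alpha> = min \<alpha>1 \<alpha>2" and "\<beta> = max \<beta>1 \<beta>2"
  have \<alpha>: "\<alpha> > 0" "\<alpha> \<le> \<alpha>1" "\<alpha> \<le> \<alpha>2" and \<beta>: "\<beta> > 0" "\<beta>1 \<le> \<beta>" "\<beta>2 \<le> \<beta>"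
    using pos1 pos2 by (auto simp: \<alpha>_def \<beta>_def)
  \<comment> \<open>The bound \<open>r \<le> \<kappa>\<close> keeps both players in the region where their energies exist.\<close>
  define \<kappa> where "\<kappa> = min \<epsilon> ((min \<eta>1 \<eta>2)\<^sup>2)"
  have \<kappa>: "\<kappa> > 0" "\<kappa> \<le> \<epsilon>" "\<kappa> \<le> (min \<eta>1 \<eta>2)\<^sup>2" using assms(13) pos1 pos2 by (auto simp: \<kappa>_def)
  \<comment> \<open>If \<open>r\<close> ever reached \<open>\<kappa>\<close>, the energy there would be at least \<open>\<alpha> * \<kappa>\<close>, while it starts below \<open>\<beta> * \<delta>\<close>.\<close>
  define \<delta> where "\<delta> = min \<kappa> (\<alpha> * \<kappa> / \<beta>)"
  have \<delta>: "\<delta> > 0" "\<delta> \<le> \<kappa>" "\<beta> * \<delta> \<le> \<alpha> * \<kappa>"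
    using \<kappa> \<alpha> \<beta> by (auto simp: \<delta>_def min_def field_simps)
  show ?thesis
  proof (rule exI[of _ \<delta>], rule conjI[OF \<delta>(1)], unfold Let_def, intro allI impI ballI, elim conjE)
    fix J \<theta> \<phi> and t1 :: real
    assume J: "is_interval J" "0 \<in> J" "J \<subseteq> {0..}" and gda: "gda_solution b c f g L J \<theta> \<phi>"
      and t1: "t1 \<in> J"
    define x y where "x t = hidden_map b f (\<theta> t)" and "y t = hidden_map c g (\<phi> t)" for t
    define r where "r t = (norm (x t - p))\<^sup>2 + (norm (y t - q))\<^sup>2" for t
    assume "(norm (hidden_map b f (\<theta> 0) - p))\<^sup>2 + (norm (hidden_map c g (\<phi> 0) - q))\<^sup>2 < \<delta>"
    then have r0: "r 0 < \<delta>" by (simp add: r_def x_def y_def)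
    have \<theta>': "((\<lambda>s. block b i (\<theta> s)) has_vector_derivative
              (- partial_x L i (x t) (y t)) *\<^sub>R
                gradient_on (block_space b i) (f i) (block b i (\<theta> t))) (at t within J)"
      and \<phi>': "((\<lambda>s. block c j (\<phi> s)) has_vector_derivative
              partial_y L j (x t) (y t) *\<^sub>R
                gradient_on (block_space c j) (g j) (block c j (\<phi> t))) (at t within J)"
      if "t \<in> J" for t i j
      using gda that unfolding gda_solution_def x_def y_def by auto
    have "continuous_on J (\<lambda>t. block b i (\<theta> t))" for i
      by (rule continuous_on_vector_derivative) (rule \<theta>')
    then have x_cont: "continuous_on J x"
      unfolding x_def[abs_def] by (rule continuous_on_hidden_map[OF assms(3)])
    have "continuous_on J (\<lambda>t. block c j (\<phi> t))" for j
      by (rule continuous_on_vector_derivative) (rule \<phi>')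
    then have y_cont: "continuous_on J y"
      unfolding y_def[abs_def] by (rule continuous_on_hidden_map[OF assms(4)])
    have r_cont: "continuous_on J r"
      unfolding r_def[abs_def] by (intro continuous_intros x_cont y_cont)
    have "r t1 < \<epsilon>"
    proof (rule ccontr)
      assume "\<not> r t1 < \<epsilon>"
      then have r_t1: "\<kappa> \<le> r t1" using \<kappa>(2) by simp
      have sub1: "{0..t1} \<subseteq> J" using mem_is_interval_1_I[OF J(1,2) t1] by auto
      obtain T where T: "T \<in> {0..t1}" "r T = \<kappa>" and r_le: "\<And>t. t \<in> {0..T} \<Longrightarrow> r t \<le> \<kappa>"
        by (rule first_hitting_time[OF continuous_on_subset[OF r_cont sub1] _ _ r_t1])
          (use r0 \<delta>(2) t1 J in auto)
      have sub: "{0..T} \<subseteq> J" using T sub1 by auto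
      have tube: "norm (x t - p) \<le> \<eta>1" "norm (y t - q) \<le> \<eta>2" if t: "t \<in> {0..T}" for t
      proof -
        have "(norm (x t - p))\<^sup>2 \<le> (min \<eta>1 \<eta>2)\<^sup>2" "(norm (y t - q))\<^sup>2 \<le> (min \<eta>1 \<eta>2)\<^sup>2"
          using order_trans[OF r_le[OF t] \<kappa>(3)] unfolding r_def
          by (auto intro: order_trans[rotated])
        then show "norm (x t - p) \<le> \<eta>1" "norm (y t - q) \<le> \<eta>2"
          using pos1 pos2 by (simp_all add: power2_le_iff_abs_le)
      qed
      have "continuous_on {0..T} (\<lambda>t. (x t, y t))"
        using x_cont y_cont sub by (intro continuous_on_Pair) (auto intro: continuous_on_subset)
      then have "continuous_on {0..T} (\<lambda>t. L' (x t, y t))"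
        by (rule continuous_on_compose2[OF L'_cont]) auto
      then have cont_a: "continuous_on {0..T} (\<lambda>t. - partial_x L i (x t) (y t))"
        "continuous_on {0..T} (\<lambda>t. partial_y L j (x t) (y t))" for i j
        unfolding partial_x_eq[OF L'] partial_y_eq[OF L'] by (auto intro!: continuous_intros)
      have "driven_flow b f T (\<lambda>i t. - partial_x L i (x t) (y t)) \<theta>"
        unfolding driven_flow_def
        by (intro conjI allI ballI cont_a(1) has_vector_derivative_within_subset[OF \<theta>' sub])
          (use sub in auto)
      from energy1[OF this, folded x_def] tube(1)
      obtain H1 where H1: "quadratic_energy T (\<lambda>i t. - partial_x L i (x t) (y t)) (\<lambda>t. x t - p) \<alpha>1 \<beta>1 H1"
        by blast
      have "driven_flow c g T (\<lambda>j t. partial_y L j (x t) (y t)) \<phi>"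
        unfolding driven_flow_def
        by (intro conjI allI ballI cont_a(2) has_vector_derivative_within_subset[OF \<phi>' sub])
          (use sub in auto)
      from energy2[OF this, folded y_def] tube(2)
      obtain H2 where H2: "quadratic_energy T (\<lambda>j t. partial_y L j (x t) (y t)) (\<lambda>t. y t - q) \<alpha>2 \<beta>2 H2"
        by blast
      \<comment> \<open>the total energy, and its rate of change rewritten by means of the derivative of \<open>L\<close>\<close>
      define H where "H t = H1 t + H2 t" for t
      define H' where "H' t = L' (x t, y t) (p - x t, 0) + L' (x t, y t) (0, y t - q)" for t
      have H: "(H has_real_derivative H' t) (at t within {0..T})" if t: "t \<in> {0..T}" for t
      proof -
        have lin: "linear (blinfun_apply (L' (x t, y t)))" by (rule has_derivative_linear[OF L'])
        have linx: "linear (\<lambda>h. L' (x t, y t) (h, 0))"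
          using linear_compose[of "\<lambda>h. (h, 0)", OF _ lin] by (simp add: o_def linear_iff)
        have liny: "linear (\<lambda>h. L' (x t, y t) (0, h))"
          using linear_compose[of "\<lambda>h. (0, h)", OF _ lin] by (simp add: o_def linear_iff)
        have "(\<Sum>i\<in>UNIV. - partial_x L i (x t) (y t) * (x t - p) $ i)
            = (\<Sum>i\<in>UNIV. L' (x t, y t) (axis i 1, 0) * (p - x t) $ i)"
          by (rule sum.cong) (auto simp: partial_x_eq[OF L'] algebra_simps)
        also have "\<dots> = L' (x t, y t) (p - x t, 0)" by (rule linear_axis_sum[OF linx])
        finally have 1: "(\<Sum>i\<in>UNIV. - partial_x L i (x t) (y t) * (x t - p) $ i)
            = L' (x t, y t) (p - x t, 0)" .
        have 2: "(\<Sum>j\<in>UNIV. partial_y L j (x t) (y t) * (y t - q) $ j) = L' (x t, y t) (0, y t - q)"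
          unfolding partial_y_eq[OF L'] by (rule linear_axis_sum[OF liny])
        show ?thesis
          unfolding H_def[abs_def] H'_def 1[symmetric] 2[symmetric]
          using H1 H2 t unfolding quadratic_energy_def by (intro DERIV_add) auto
      qed
      have H'_le: "H' t \<le> 0" for t
        unfolding H'_def by (rule saddle_monotonicity[OF assms(6,7) L'])
      have "\<exists>s\<in>{0..T}. H T - H 0 = H' s * (T - 0)"
        by (rule mvt_very_simple[where f'="\<lambda>s h. H' s * h"])
          (use H T(1) in \<open>auto simp: has_field_derivative_def\<close>)
      then obtain s where "H T - H 0 = H' s * T" by auto
      moreover have "H' s * T \<le> 0" using H'_le[of s] T(1) by (intro mult_nonpos_nonneg) auto
      ultimately have "H T \<le> H 0" by simp
      moreover have "\<alpha> * r T \<le> H T"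
      proof -
        have "\<alpha>1 * (norm (x T - p))\<^sup>2 \<le> H1 T" "\<alpha>2 * (norm (y T - q))\<^sup>2 \<le> H2 T"
          using H1 H2 T(1) by (simp_all add: quadratic_energy_def)
        then have "\<alpha> * (norm (x T - p))\<^sup>2 \<le> H1 T" "\<alpha> * (norm (y T - q))\<^sup>2 \<le> H2 T"
          using \<alpha> by (meson mult_right_mono order_trans zero_le_power2)+
        then show ?thesis unfolding r_def H_def distrib_left by (rule add_mono)
      qed
      moreover have "H 0 \<le> \<beta> * r 0"
      proof -
        have "H1 0 \<le> \<beta>1 * (norm (x 0 - p))\<^sup>2" "H2 0 \<le> \<beta>2 * (norm (y 0 - q))\<^sup>2"
          using H1 H2 T(1) by (simp_all add: quadratic_energy_def)
        then have "H1 0 \<le> \<beta> * (norm (x 0 - p))\<^sup>2" "H2 0 \<le> \<beta> * (norm (y 0 - q))\<^sup>2"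
          using \<beta> by (meson mult_right_mono order_trans zero_le_power2)+
        then show ?thesis unfolding r_def H_def distrib_left by (rule add_mono)
      qed
      moreover have "\<beta> * r 0 < \<beta> * \<delta>" using r0 \<beta>(1) by simp
      ultimately show False using T(2) \<delta>(3) by simp
    qed
    then show "(norm (hidden_map b f (\<theta> t1) - p))\<^sup>2 + (norm (hidden_map c g (\<phi> t1) - q))\<^sup>2 < \<epsilon>"
      by (simp add: r_def x_def y_def)
  qed
qed

end
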